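(* Let $\Omega$ be a countably infinite set. Then the pointwise topology is the only Polish topology on $\Omega^\Omega$ with respect to which $\Omega^\Omega$ is a semitopological semigroup.
   Context: $\Omega^\Omega$ is the monoid of all functions $\Omega\to\Omega$ under composition. The pointwise topology on $\Omega^\Omega$ is the product topology on $\prod_\Omega\Omega$ with each factor $\Omega$ discrete. A topology is Polish if it is separable and completely metrizable. A semigroup $S$ with a topology is semitopological if for every $s\in S$ the maps $x\mapsto xs$ and $x\mapsto sx$ are continuous maps $S\to S$. *)

theory Defs
  imports "HOL-Analysis.Analysis" "HOL-Algebra.Group"
begin

text \<open>
  Functions from \<open>\<Omega>\<close> to \<open>\<Omega>\<close>, for a set \<open>\<Omega>\<close>, are the extensional functions
  \<open>\<Omega> \<rightarrow>\<^sub>E \<Omega>\<close>: they take the value \<open>undefined\<close> outside \<open>\<Omega>\<close>, so that each function on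
  \<open>\<Omega>\<close> is represented exactly once.  For \<open>\<Omega> = UNIV\<close> they are all functions of the type.
\<close>

definition full_transformation_monoid :: "'a set \<Rightarrow> ('a \<Rightarrow> 'a) monoid" where
  "full_transformation_monoid \<Omega> =
    \<lparr>carrier = \<Omega> \<rightarrow>\<^sub>E \<Omega>, mult = (\<lambda>f g. compose \<Omega> f g), one = (\<lambda>x\<in>\<Omega>. x)\<rparr>"

lemma monoid_full_transformation_monoid: "monoid (full_transformation_monoid \<Omega>)"
  by (rule monoidI)
     (auto simp: full_transformation_monoid_def compose_def fun_eq_iff PiE_iff
        extensional_def restrict_def)

definition pointwise_topology :: "'a set \<Rightarrow> ('a \<Rightarrow> 'a) topology" where
  "pointwise_topology \<Omega> = product_topology (\<lambda>_. discrete_topology \<Omega>) \<Omega>"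

lemma topspace_pointwise_topology:
  "topspace (pointwise_topology \<Omega>) = carrier (full_transformation_monoid \<Omega>)"
  by (simp add: pointwise_topology_def full_transformation_monoid_def)

definition Polish_topology :: "'a topology \<Rightarrow> bool" where
  "Polish_topology T \<longleftrightarrow> separable_space T \<and> completely_metrizable_space T"

text \<open>
  Only the carrier and the multiplication of the record \<open>S\<close> are used.  The first conjunct
  says that \<open>T\<close> is a topology on the carrier of \<open>S\<close>; the next two that \<open>S\<close> is a
  semigroup.
\<close>

definition semitopological_semigroup :: "('a, 'b) monoid_scheme \<Rightarrow> 'a topology \<Rightarrow> bool" where
  "semitopological_semigroup S T \<longleftrightarrow>
    topspace T = carrier S \<and>
    (\<forall>x\<in>carrier S. \<forall>y\<in>carrier S. x \<otimes>\<^bsub>S\<^esub> y \<in> carrier S) \<and>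
    (\<forall>x\<in>carrier S. \<forall>y\<in>carrier S. \<forall>z\<in>carrier S.
       (x \<otimes>\<^bsub>S\<^esub> y) \<otimes>\<^bsub>S\<^esub> z = x \<otimes>\<^bsub>S\<^esub> (y \<otimes>\<^bsub>S\<^esub> z)) \<and>
    (\<forall>s\<in>carrier S. continuous_map T T (\<lambda>x. x \<otimes>\<^bsub>S\<^esub> s) \<and>
                   continuous_map T T (\<lambda>x. s \<otimes>\<^bsub>S\<^esub> x))"

end

theory Submission
  imports Defs
begin

text \<open>
  Let \<open>T\<close> be a competing topology and write \<open>P\<close> for the pointwise one.  Multiplying by
  constant maps shows \<open>P \<subseteq> T\<close>.  Since \<open>T\<close> is Polish, the identity from \<open>P\<close> to \<open>T\<close> is
  continuous off a \<open>P\<close>-meagre set \<open>R\<close>.  If \<open>s\<^sub>n \<rightarrow> s\<close> in \<open>P\<close>, write \<open>s\<^sub>n = t\<^sub>n g\<close> and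
  \<open>s = t g\<close> for a fixed injective \<open>g\<close> and surjective \<open>t\<^sub>n \<rightarrow> t\<close>.  Left multiplication by a
  surjection is \<open>P\<close>-open, so a \<open>P\<close>-generic \<open>h\<close> is surjective with all \<open>t\<^sub>n h\<close> and \<open>t h\<close>
  outside \<open>R\<close>; hence \<open>t\<^sub>n h \<rightarrow> t h\<close> in \<open>T\<close>.  Multiplying on the right by \<open>k g\<close>, where \<open>k\<close> is
  a right inverse of \<open>h\<close>, gives \<open>s\<^sub>n \<rightarrow> s\<close> in \<open>T\<close>.
\<close>

section \<open>Category in topological spaces\<close>

text \<open>The covering pieces are closed with empty interior. This agrees with covering by nowhere
  dense sets, since their closures are again nowhere dense, and it is the form that the Baire
  category theorem takes.\<close>

definition meagre_in :: "'a topology \<Rightarrow> 'a set \<Rightarrow> bool" where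
  "meagre_in X A \<longleftrightarrow>
    (\<exists>\<N>. countable \<N> \<and> (\<forall>N\<in>\<N>. closedin X N \<and> X interior_of N = {}) \<and> A \<subseteq> \<Union>\<N>)"

lemma meagre_in_subset: "meagre_in X B \<Longrightarrow> A \<subseteq> B \<Longrightarrow> meagre_in X A"
  unfolding meagre_in_def by (meson subset_trans)

lemma meagre_in_nowhere_dense:
  assumes "closedin X A" "X interior_of A = {}"
  shows "meagre_in X A"
  unfolding meagre_in_def using assms by (intro exI[of _ "{A}"]) auto

lemma meagre_in_UN:
  assumes "countable I" "\<And>i. i \<in> I \<Longrightarrow> meagre_in X (A i)"
  shows "meagre_in X (\<Union>i\<in>I. A i)"
proof -
  obtain \<N> where \<N>: "\<And>i. i \<in> I \<Longrightarrow> countable (\<N> i) \<and>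
      (\<forall>N\<in>\<N> i. closedin X N \<and> X interior_of N = {}) \<and> A i \<subseteq> \<Union>(\<N> i)"
    using assms(2) unfolding meagre_in_def by metis
  show ?thesis
    unfolding meagre_in_def
    using \<N> assms(1) by (intro exI[of _ "\<Union>i\<in>I. \<N> i"]) (auto, blast)
qed

lemma meagre_in_Un:
  assumes "meagre_in X A" "meagre_in X B"
  shows "meagre_in X (A \<union> B)"
proof -
  have "meagre_in X (\<Union>b\<in>UNIV. if b then A else B)"
    by (rule meagre_in_UN) (use assms in auto)
  then show ?thesis
    by (rule meagre_in_subset) auto
qed

text \<open>By Baire, the union of the covering family has empty interior, whereas a family covering
  the space has the whole space as its union.\<close>

lemma Baire_not_meagre_in_topspace:
  assumes X: "completely_metrizable_space X" and ne: "topspace X \<noteq> {}"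
  shows "\<not> meagre_in X (topspace X)"
proof
  assume "meagre_in X (topspace X)"
  then obtain \<N> where \<N>: "countable \<N>" "\<And>N. N \<in> \<N> \<Longrightarrow> closedin X N"
      "\<And>N. N \<in> \<N> \<Longrightarrow> X interior_of N = {}" and cover: "topspace X \<subseteq> \<Union>\<N>"
    unfolding meagre_in_def by blast
  have "X interior_of \<Union>\<N> = {}"
    using X \<N> by (intro Baire_category_alt) auto
  moreover have "X interior_of \<Union>\<N> = topspace X"
    using cover \<N>(2) by (metis closedin_subset Sup_least interior_of_topspace subset_antisym)
  ultimately show False
    using ne by simp
qed

section \<open>Polish topologies finer than a Hausdorff topology\<close>

text \<open>Balls of radius \<open>inverse (real (Suc n))\<close> about a countable dense set form a
  base; radii below \<open>r / 2\<close> suffice by the triangle inequality.\<close>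

lemma (in Metric_space) separable_imp_second_countable:
  assumes "separable_space mtopology"
  shows "second_countable mtopology"
proof -
  obtain D where D: "countable D" "D \<subseteq> M" "mtopology closure_of D = M"
    using assms unfolding separable_space_def by auto
  define \<B> where "\<B> = (\<lambda>(c, n). mball c (inverse (real (Suc n)))) ` (D \<times> UNIV)"
  have "\<exists>V\<in>\<B>. x \<in> V \<and> V \<subseteq> U" if U: "openin mtopology U" and x: "x \<in> U" for U x
  proof -
    obtain r where r: "r > 0" "mball x r \<subseteq> U"
      using U x openin_mtopology by blast
    obtain n where n: "inverse (real (Suc n)) < r / 2"
      using r reals_Archimedean[of "r / 2"] by auto
    have xM: "x \<in> M"
      using U x openin_subset by fastforce
    then obtain c where c: "c \<in> D" "c \<in> mball x (inverse (real (Suc n)))"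
      using D(3) metric_closure_of[of D] inverse_positive_iff_positive[of "real (Suc n)"]
      by (smt (verit) mem_Collect_eq of_nat_0_less_iff zero_less_Suc)
    have "x \<in> mball c (inverse (real (Suc n)))"
      using c by (simp add: commute)
    moreover have "mball c (inverse (real (Suc n))) \<subseteq> mball x r"
    proof
      fix z assume z: "z \<in> mball c (inverse (real (Suc n)))"
      then show "z \<in> mball x r"
        using c n triangle[of x c z] xM by (auto simp del: of_nat_Suc)
    qed
    ultimately show ?thesis
      using c r unfolding \<B>_def by force
  qed
  moreover have "countable \<B>" "\<forall>V\<in>\<B>. openin mtopology V"
    unfolding \<B>_def using D(1) by auto
  ultimately show ?thesis
    unfolding second_countable_def by blast
qed

text \<open>In effect the identity from \<open>P\<close> to \<open>T\<close> is continuous on the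
  complement of \<open>R\<close>. Each member \<open>B\<close> of a countable base of
  \<open>T\<close> is matched with a \<open>P\<close>-open set \<open>h B\<close>, and
  \<open>R\<close> collects the countably many meagre errors.\<close>

theorem Polish_refinement_agrees_off_meagre:
  assumes T: "Polish_topology T" and P: "Hausdorff_space P"
    and top: "topspace T = topspace P" and finer: "\<And>U. openin P U \<Longrightarrow> openin T U"
  obtains R where "meagre_in P R"
    "\<And>U. openin T U \<Longrightarrow> \<exists>V. openin P V \<and> U - R = V - R"
proof -
  obtain M d where "Metric_space M d" and complete: "Metric_space.mcomplete M d"
    and T_eq: "T = Metric_space.mtopology M d"
    using T unfolding Polish_topology_def completely_metrizable_space_def by auto
  interpret Metric_space M d by fact
  have topP: "topspace P = M"
    using top T_eq by simp
  have "second_countable T"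
    using T separable_imp_second_countable unfolding Polish_topology_def T_eq by blast
  then obtain \<B> where \<B>_base: "countable \<B> \<and> (\<forall>B\<in>\<B>. openin T B) \<and>
      (\<forall>U x. openin T U \<and> x \<in> U \<longrightarrow> (\<exists>B\<in>\<B>. x \<in> B \<and> B \<subseteq> U))"
    unfolding second_countable_def ..
  then have \<B>: "countable \<B>" "\<And>B. B \<in> \<B> \<Longrightarrow> openin T B"
    by simp_all
  have base: "\<exists>B\<in>\<B>. x \<in> B \<and> B \<subseteq> U" if "openin T U" "x \<in> U" for U x
    using \<B>_base that by simp
  have \<B>_sub: "B \<subseteq> topspace P" if "B \<in> \<B>" for B
    using \<B>(2)[OF that] openin_subset top by metis
  \<comment> \<open>Once \<open>Z\<close> is discarded, no remaining point has a
    \<open>P\<close>-meagre basic neighbourhood.\<close>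
  define Z where "Z = \<Union>{B \<in> \<B>. meagre_in P B}"
  have Z: "meagre_in P Z"
  proof -
    have "meagre_in P (\<Union>B\<in>{B \<in> \<B>. meagre_in P B}. B)"
      using \<B>(1) by (intro meagre_in_UN) simp_all
    then show ?thesis
      by (simp add: Z_def)
  qed
  define h where "h B = P interior_of (P closure_of (B - Z))" for B
  have h_open: "openin P (h B)" for B
    by (simp add: h_def)
  have h_closure: "h B \<subseteq> P closure_of (B - Z)" for B
    by (simp add: h_def interior_of_subset)
  have h_meets: "W \<inter> (B - Z) \<noteq> {}" if "openin P W" "x \<in> W" "x \<in> h B" for W B x
  proof -
    have "x \<in> P closure_of (B - Z)"
      using that(3) h_closure by blast
    then show ?thesis
      using that(1,2) unfolding in_closure_of by (metis IntI empty_iff)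
  qed
  \<comment> \<open>If the closure of \<open>B - Z\<close> had empty interior, then \<open>B\<close>
    would be meagre and therefore swallowed by \<open>Z\<close>.\<close>
  have h_nonempty: "h B \<noteq> {}" if B: "B \<in> \<B>" and ne: "B - Z \<noteq> {}" for B
  proof
    assume "h B = {}"
    then have "meagre_in P (P closure_of (B - Z))"
      by (intro meagre_in_nowhere_dense) (auto simp: h_def)
    then have "meagre_in P (P closure_of (B - Z) \<union> Z)"
      using Z by (rule meagre_in_Un)
    then have "meagre_in P B"
      using closure_of_subset[of "B - Z" P] \<B>_sub[OF B] by (auto elim!: meagre_in_subset)
    then show False
      using B ne by (auto simp: Z_def)
  qed
  \<comment> \<open>The conditions concern the closure of \<open>C\<close>, so that a branch of
    successive refinements gives nested \<open>T\<close>-closed sets to which completeness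
    applies.\<close>
  define refine where
    "refine n B = {C \<in> \<B>. T closure_of C \<subseteq> B \<and>
       (\<exists>a. T closure_of C \<subseteq> mcball a (inverse (real (Suc n))))}" for n B
  define N where "N B n = P closure_of h B - \<Union>(h ` refine n B)" for B n
  \<comment> \<open>A nonempty interior would meet \<open>h B\<close>, hence contain a point
    \<open>y\<close> of \<open>B - Z\<close>. A small basic set \<open>C\<close> about
    \<open>y\<close> lies in that interior and refines \<open>B\<close>. The nonempty set
    \<open>h C\<close> meets \<open>C\<close>, although \<open>N B n\<close> omits
    \<open>h C\<close>.\<close>
  have N: "meagre_in P (N B n)" if B: "B \<in> \<B>" for B n
  proof (rule meagre_in_nowhere_dense)
    show "closedin P (N B n)"
      unfolding N_def using h_open by (intro closedin_diff closedin_closure_of openin_Union) auto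
    show "P interior_of N B n = {}"
    proof (rule ccontr)
      assume "P interior_of N B n \<noteq> {}"
      then obtain w where w: "w \<in> P interior_of N B n" by blast
      define W where "W = P interior_of N B n \<inter> h B"
      have W: "openin P W"
        unfolding W_def using h_open by auto
      have "w \<in> P closure_of h B"
        using w interior_of_subset[of P "N B n"] by (auto simp: N_def)
      then obtain w' where "w' \<in> W"
        using w unfolding W_def in_closure_of by (metis IntI openin_interior_of)
      then obtain y where y: "y \<in> W" "y \<in> B" "y \<notin> Z"
        using h_meets[OF W, of w' B] by (auto simp: W_def)
      have "openin T (W \<inter> B)"
        using finer[OF W] \<B>(2)[OF B] by blast
      then obtain r where r: "r > 0" "mcball y r \<subseteq> W \<inter> B"
        using y openin_mtopology_mcball[of "W \<inter> B"] T_eq by auto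
      \<comment> \<open>Both demands are met at once: \<open>r\<close> keeps the closure of
        \<open>C\<close> inside \<open>W \<inter> B\<close>, and the other term bounds its size as
        \<open>refine\<close> asks.\<close>
      define e where "e = min r (inverse (real (Suc n)))"
      have "e > 0" "e \<le> r" "e \<le> inverse (real (Suc n))"
        using r by (auto simp: e_def)
      have yM: "y \<in> M"
        using y(1) W openin_subset topP by blast
      obtain C where C: "C \<in> \<B>" "y \<in> C" "C \<subseteq> mball y e"
        using base[of "mball y e" y] T_eq yM \<open>e > 0\<close> by auto
      have cl: "T closure_of C \<subseteq> mcball y e"
        using C(3) mball_subset_mcball[of y e] T_eq by (intro closure_of_minimal) auto
      have "C \<in> refine n B"
        unfolding refine_def
        using C(1) cl r mcball_subset_concentric[OF \<open>e \<le> r\<close>, of y]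
          mcball_subset_concentric[OF \<open>e \<le> inverse (real (Suc n))\<close>, of y] by blast
      have "C \<subseteq> W"
        using cl r(2) mcball_subset_concentric[OF \<open>e \<le> r\<close>, of y] closure_of_subset[of C T]
          \<B>_sub[OF C(1)] top by blast
      obtain z where z: "z \<in> h C"
        using h_nonempty[OF C(1)] C(2) y(3) by blast
      then have "h C \<inter> (C - Z) \<noteq> {}"
        using h_meets[OF h_open] by blast
      then obtain v where "v \<in> h C" "v \<in> W"
        using \<open>C \<subseteq> W\<close> by blast
      then show False
        using \<open>C \<in> refine n B\<close> interior_of_subset[of P "N B n"] by (auto simp: W_def N_def)
    qed
  qed
  \<comment> \<open>This is the boundary of a closed set, hence nowhere dense.\<close>
  define F where "F B = P closure_of (B - Z) - h B" for B
  have F: "meagre_in P (F B)" for B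
  proof (rule meagre_in_nowhere_dense)
    show "closedin P (F B)"
      unfolding F_def by (intro closedin_diff closedin_closure_of h_open)
    have "P interior_of F B \<subseteq> h B"
      unfolding h_def by (rule interior_of_mono) (auto simp: F_def)
    then show "P interior_of F B = {}"
      using interior_of_subset[of P "F B"] by (auto simp: F_def)
  qed
  \<comment> \<open>Off \<open>R\<close>, each basic \<open>T\<close>-open \<open>B\<close> coincides with the \<open>P\<close>-open set \<open>h B\<close>: a point of
    \<open>h B\<close> lies in \<open>h (C n)\<close> along a branch of shrinking \<open>C n\<close>, hence is the \<open>T\<close>-limit of it.\<close>
  define R where "R = (Z \<union> (\<Union>B\<in>\<B>. F B)) \<union> (\<Union>B\<in>\<B>. \<Union>n\<in>UNIV. N B n)"
  have R: "meagre_in P R"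
    unfolding R_def using Z F N \<B>(1) by (intro meagre_in_Un meagre_in_UN) auto
  have to_h: "x \<in> h B" if "B \<in> \<B>" "x \<in> B" "x \<notin> R" for B x
    using that closure_of_subset[of "B - Z" P] \<B>_sub[of B] by (auto simp: R_def F_def)
  have from_h: "x \<in> B" if B: "B \<in> \<B>" and x: "x \<in> h B" "x \<notin> R" for B x
  proof -
    \<comment> \<open>Since \<open>x\<close> lies outside \<open>N C n\<close>, some refinement
      \<open>C'\<close> of \<open>C\<close> has \<open>x\<close> in \<open>h C'\<close>. The clause
      about index 0 anchors the branch at \<open>B\<close> in the dependent choice.\<close>
    have step: "\<exists>C'. (C' \<in> \<B> \<and> x \<in> h C' \<and> (Suc n = 0 \<longrightarrow> C' = B)) \<and> C' \<in> refine n C"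
      if C: "C \<in> \<B> \<and> x \<in> h C \<and> (n = 0 \<longrightarrow> C = B)" for C n
    proof -
      have "x \<in> P closure_of h C"
        using C closure_of_subset[of "h C" P] openin_subset[OF h_open] by blast
      moreover have "x \<notin> N C n"
        using C x(2) by (auto simp: R_def)
      ultimately show ?thesis
        by (auto simp: N_def refine_def)
    qed
    obtain C where "\<forall>n. (C n \<in> \<B> \<and> x \<in> h (C n) \<and> (n = 0 \<longrightarrow> C n = B)) \<and>
        C (Suc n) \<in> refine n (C n)"
      using dependent_nat_choice[where P = "\<lambda>n C. C \<in> \<B> \<and> x \<in> h C \<and> (n = 0 \<longrightarrow> C = B)"
          and Q = "\<lambda>n C C'. C' \<in> refine n C", OF _ step] B x(1) by auto
    then have C: "C n \<in> \<B>" "x \<in> h (C n)" "C 0 = B" and ref: "C (Suc n) \<in> refine n (C n)" for n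
      by simp_all
    let ?K = "\<lambda>n. T closure_of C n"
    have C_sub: "C n \<subseteq> ?K n" for n
      using closure_of_subset[of "C n" T] \<B>_sub[OF C(1)] top by metis
    have next_sub: "?K (Suc n) \<subseteq> C n" for n
      using ref by (auto simp: refine_def)
    have C_ne: "C n \<noteq> {}" for n
      using h_meets[OF h_open C(2) C(2), of n] by blast
    have small: "\<exists>n a. ?K n \<subseteq> mcball a e" if e: "e > 0" for e
    proof -
      obtain n where n: "inverse (real (Suc n)) < e"
        using reals_Archimedean[OF e] by auto
      obtain a where "?K (Suc n) \<subseteq> mcball a (inverse (real (Suc n)))"
        using ref[of n] by (auto simp: refine_def)
      then show ?thesis
        using mcball_subset_concentric[of "inverse (real (Suc n))" e a] n by (meson less_imp_le order_trans)
    qed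
    have "decseq ?K"
      unfolding decseq_Suc_iff using C_sub next_sub by blast
    moreover have "\<forall>n. closedin mtopology (?K n)"
      using T_eq by simp
    moreover have "\<forall>n. ?K n \<noteq> {}"
      using C_ne C_sub by blast
    ultimately have "\<Inter>(range ?K) \<noteq> {}"
      using complete[unfolded mcomplete_nest, rule_format, of ?K] small by blast
    then obtain y where y: "\<And>n. y \<in> ?K n"
      by blast
    \<comment> \<open>Index 1 is used because it is the closure of \<open>C 1\<close>, not that of
      \<open>C 0\<close>, which is known to lie in \<open>B\<close>.\<close>
    have "y \<in> B"
      using y[of "Suc 0"] next_sub[of 0] C(3) by auto
    \<comment> \<open>Otherwise separate \<open>x\<close> and \<open>y\<close> by
      \<open>P\<close>-open sets \<open>U\<close> and \<open>V\<close>. As \<open>V\<close> is also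
      \<open>T\<close>-open, it contains some \<open>C n\<close>: two points of a closed ball of
      radius \<open>r / 3\<close> are less than \<open>r\<close> apart. But \<open>x\<close> in
      \<open>h (C n)\<close> forces \<open>U\<close> to meet \<open>C n\<close>.\<close>
    have "x = y"
    proof (rule ccontr)
      assume "x \<noteq> y"
      moreover have "x \<in> topspace P" "y \<in> topspace P"
        using x(1) openin_subset[OF h_open] \<B>_sub[OF B] \<open>y \<in> B\<close> by blast+
      ultimately obtain U V where U: "openin P U" "x \<in> U" and V: "openin P V" "y \<in> V"
        and disj: "disjnt U V"
        using P unfolding Hausdorff_space_def by meson
      obtain r where r: "r > 0" "mball y r \<subseteq> V"
        using finer[OF V(1)] V(2) openin_mtopology[of V] T_eq by auto
      obtain n a where n: "?K n \<subseteq> mcball a (r / 3)"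
        using small[of "r / 3"] r(1) by auto
      have "C n \<subseteq> mball y r"
      proof
        fix z assume "z \<in> C n"
        then have "z \<in> mcball a (r / 3)" "y \<in> mcball a (r / 3)"
          using n C_sub y by blast+
        then show "z \<in> mball y r"
          using triangle[of y a z] r(1) by (auto simp: commute)
      qed
      then have "C n \<inter> U = {}"
        using r(2) disj by (auto simp: disjnt_def)
      then show False
        using h_meets[OF U C(2), of n] by blast
    qed
    then show ?thesis
      using \<open>y \<in> B\<close> by simp
  qed
  have "\<exists>V. openin P V \<and> U - R = V - R" if U: "openin T U" for U
  proof (intro exI conjI)
    show "openin P (\<Union>(h ` {B \<in> \<B>. B \<subseteq> U}))"
      using h_open by blast
    show "U - R = \<Union>(h ` {B \<in> \<B>. B \<subseteq> U}) - R"
    proof (intro subset_antisym subsetI)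
      fix x assume x: "x \<in> U - R"
      then obtain B where "B \<in> \<B>" "x \<in> B" "B \<subseteq> U"
        using base[OF U, of x] by auto
      then show "x \<in> \<Union>(h ` {B \<in> \<B>. B \<subseteq> U}) - R"
        using x to_h[of B x] by auto
    next
      fix x assume "x \<in> \<Union>(h ` {B \<in> \<B>. B \<subseteq> U}) - R"
      then show "x \<in> U - R"
        using from_h[of _ x] by auto
    qed
  qed
  then show ?thesis
    using R that by blast
qed

section \<open>The pointwise topology\<close>

lemma topspace_pointwise [simp]: "topspace (pointwise_topology \<Omega>) = \<Omega> \<rightarrow>\<^sub>E \<Omega>"
  by (simp add: pointwise_topology_def)

text \<open>A basic box constrains finitely many coordinates, and conversely agreement with
  \<open>f\<close> on a finite set is a box with singleton factors. Later arguments use this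
  finite-agreement form.\<close>

lemma openin_pointwise_topology:
  "openin (pointwise_topology \<Omega>) U \<longleftrightarrow> U \<subseteq> \<Omega> \<rightarrow>\<^sub>E \<Omega> \<and>
    (\<forall>f\<in>U. \<exists>F. finite F \<and> F \<subseteq> \<Omega> \<and> (\<forall>g\<in>\<Omega> \<rightarrow>\<^sub>E \<Omega>. (\<forall>x\<in>F. g x = f x) \<longrightarrow> g \<in> U))"
  (is "?L \<longleftrightarrow> ?R")
proof
  assume L: ?L
  have "\<exists>F. finite F \<and> F \<subseteq> \<Omega> \<and> (\<forall>g\<in>\<Omega> \<rightarrow>\<^sub>E \<Omega>. (\<forall>x\<in>F. g x = f x) \<longrightarrow> g \<in> U)"
    if f: "f \<in> U" for f
  proof -
    obtain W where W: "finite {i \<in> \<Omega>. W i \<noteq> \<Omega>}" "f \<in> Pi\<^sub>E \<Omega> W" "Pi\<^sub>E \<Omega> W \<subseteq> U"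
      using L f unfolding pointwise_topology_def openin_product_topology_alt by force
    have "g \<in> Pi\<^sub>E \<Omega> W" if "g \<in> \<Omega> \<rightarrow>\<^sub>E \<Omega>" "\<forall>x\<in>{i \<in> \<Omega>. W i \<noteq> \<Omega>}. g x = f x" for g
    proof (rule PiE_I)
      fix x assume x: "x \<in> \<Omega>"
      show "g x \<in> W x"
        using that x W(2) by (cases "W x = \<Omega>") (auto simp: PiE_iff)
    qed (use that in \<open>auto simp: PiE_iff extensional_def\<close>)
    then show ?thesis
      using W by (intro exI[of _ "{i \<in> \<Omega>. W i \<noteq> \<Omega>}"]) (auto simp del: PiE_iff, blast)
  qed
  then show ?R
    using openin_subset[OF L] by auto
next
  assume R: ?R
  show ?L
    unfolding pointwise_topology_def openin_product_topology_alt
  proof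
    fix f assume f: "f \<in> U"
    then obtain F where F: "finite F" "F \<subseteq> \<Omega>"
        "\<And>g. g \<in> \<Omega> \<rightarrow>\<^sub>E \<Omega> \<Longrightarrow> (\<forall>x\<in>F. g x = f x) \<Longrightarrow> g \<in> U"
      using R by meson
    define W where "W i = (if i \<in> F then {f i} else \<Omega>)" for i
    have fE: "f \<in> \<Omega> \<rightarrow>\<^sub>E \<Omega>"
      using R f by blast
    have W_sub: "W i \<subseteq> \<Omega>" if "i \<in> \<Omega>" for i
      using fE that by (auto simp: W_def)
    show "\<exists>W. finite {i \<in> \<Omega>. W i \<noteq> topspace (discrete_topology \<Omega>)} \<and>
        (\<forall>i\<in>\<Omega>. openin (discrete_topology \<Omega>) (W i)) \<and> f \<in> Pi\<^sub>E \<Omega> W \<and> Pi\<^sub>E \<Omega> W \<subseteq> U"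
    proof (intro exI[of _ W] conjI)
      show "finite {i \<in> \<Omega>. W i \<noteq> topspace (discrete_topology \<Omega>)}"
        by (rule finite_subset[OF _ F(1)]) (auto simp: W_def)
      show "f \<in> Pi\<^sub>E \<Omega> W"
        using fE by (auto simp: W_def PiE_iff)
      show "Pi\<^sub>E \<Omega> W \<subseteq> U"
      proof
        fix g assume g: "g \<in> Pi\<^sub>E \<Omega> W"
        then have "g \<in> \<Omega> \<rightarrow>\<^sub>E \<Omega>"
          using W_sub by (auto simp: PiE_iff)
        moreover have "g x = f x" if "x \<in> F" for x
          using PiE_mem[OF g, of x] that F(2) by (auto simp: W_def)
        ultimately show "g \<in> U"
          using F(3) by blast
      qed
    qed (use W_sub in auto)
  qed
qed

lemma openin_pointwise_topologyD:
  assumes "openin (pointwise_topology \<Omega>) U" "f \<in> U"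
  shows "\<exists>F. finite F \<and> F \<subseteq> \<Omega> \<and> (\<forall>g\<in>\<Omega> \<rightarrow>\<^sub>E \<Omega>. (\<forall>x\<in>F. g x = f x) \<longrightarrow> g \<in> U)"
  using assms by (simp add: openin_pointwise_topology)

lemma compose_in_PiE: "f \<in> \<Omega> \<rightarrow>\<^sub>E \<Omega> \<Longrightarrow> g \<in> \<Omega> \<rightarrow>\<^sub>E \<Omega> \<Longrightarrow> compose \<Omega> f g \<in> \<Omega> \<rightarrow>\<^sub>E \<Omega>"
  by (auto simp: compose_def)

text \<open>Complete metrizability passes to countable products of discrete spaces. The functions
  equal to a default value \<open>c\<close> off a finite set are countably many, and they realise
  every prescription on finitely many coordinates, so they are dense.\<close>

lemma pointwise_topology_Polish:
  assumes "countable \<Omega>" "\<Omega> \<noteq> {}"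
  shows "Polish_topology (pointwise_topology \<Omega>)"
  unfolding Polish_topology_def
proof
  show "completely_metrizable_space (pointwise_topology \<Omega>)"
    unfolding pointwise_topology_def
    using assms(1) by (auto simp: completely_metrizable_space_product_topology
        completely_metrizable_space_discrete_topology intro: countable_subset)
  obtain c where c: "c \<in> \<Omega>"
    using assms(2) by blast
  define ext where "ext F f = (\<lambda>x\<in>\<Omega>. if x \<in> F then f x else c)" for F and f :: "'a \<Rightarrow> 'a"
  define D where "D = (\<Union>F\<in>{F. finite F \<and> F \<subseteq> \<Omega>}. ext F ` (F \<rightarrow>\<^sub>E \<Omega>))"
  have D_sub: "D \<subseteq> \<Omega> \<rightarrow>\<^sub>E \<Omega>"
    using c by (auto simp: D_def ext_def)
  have "countable D"
    unfolding D_def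
    using assms(1)
    by (intro countable_UN countable_Collect_finite_subset countable_image countable_PiE) auto
  moreover have "pointwise_topology \<Omega> closure_of D = topspace (pointwise_topology \<Omega>)"
  proof -
    have "\<exists>g\<in>D. g \<in> U" if U: "openin (pointwise_topology \<Omega>) U" and f: "f \<in> U" for U f
    proof -
      have fE: "f \<in> \<Omega> \<rightarrow>\<^sub>E \<Omega>"
        using U f unfolding openin_pointwise_topology by blast
      obtain F where F: "finite F" "F \<subseteq> \<Omega>"
          "\<forall>g\<in>\<Omega> \<rightarrow>\<^sub>E \<Omega>. (\<forall>x\<in>F. g x = f x) \<longrightarrow> g \<in> U"
        using openin_pointwise_topologyD[OF U f] by (elim exE conjE) (rule that)
      have g: "ext F (restrict f F) \<in> D"
      proof -
        have "restrict f F \<in> F \<rightarrow>\<^sub>E \<Omega>"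
          using F(2) fE by auto
        then show ?thesis
          using F(1,2) unfolding D_def by blast
      qed
      moreover have "\<forall>x\<in>F. ext F (restrict f F) x = f x"
        using F(2) by (auto simp: ext_def)
      ultimately show ?thesis
        using F(3) D_sub by blast
    qed
    then show ?thesis
      by (auto simp: closure_of_def)
  qed
  ultimately show "separable_space (pointwise_topology \<Omega>)"
    using D_sub unfolding separable_space_def by auto
qed

lemma pointwise_topology_semitopological:
  "semitopological_semigroup (full_transformation_monoid \<Omega>) (pointwise_topology \<Omega>)"
proof -
  interpret monoid "full_transformation_monoid \<Omega>"
    by (rule monoid_full_transformation_monoid)
  \<comment> \<open>It suffices that each coordinate of the image depends on a single coordinate of
    the argument. Multiplying by \<open>s\<close> on the right reads coordinate \<open>s x\<close>;
    multiplying on the left reads coordinate \<open>x\<close>.\<close>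
  have cont: "continuous_map (pointwise_topology \<Omega>) (pointwise_topology \<Omega>) \<phi>"
    if \<phi>: "\<And>f. f \<in> \<Omega> \<rightarrow>\<^sub>E \<Omega> \<Longrightarrow> \<phi> f \<in> \<Omega> \<rightarrow>\<^sub>E \<Omega>"
      and dep: "\<And>x. x \<in> \<Omega> \<Longrightarrow> \<exists>y\<in>\<Omega>. \<forall>f\<in>\<Omega> \<rightarrow>\<^sub>E \<Omega>. \<forall>g\<in>\<Omega> \<rightarrow>\<^sub>E \<Omega>. f y = g y \<longrightarrow> \<phi> f x = \<phi> g x"
    for \<phi>
  proof -
    obtain y where y: "\<And>x. x \<in> \<Omega> \<Longrightarrow> y x \<in> \<Omega>"
      "\<And>x f g. x \<in> \<Omega> \<Longrightarrow> f \<in> \<Omega> \<rightarrow>\<^sub>E \<Omega> \<Longrightarrow> g \<in> \<Omega> \<rightarrow>\<^sub>E \<Omega> \<Longrightarrow> f (y x) = g (y x) \<Longrightarrow> \<phi> f x = \<phi> g x"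
      using dep by metis
    have "openin (pointwise_topology \<Omega>) {f \<in> \<Omega> \<rightarrow>\<^sub>E \<Omega>. \<phi> f \<in> U}"
      if U: "openin (pointwise_topology \<Omega>) U" for U
      unfolding openin_pointwise_topology
    proof (intro conjI ballI)
      fix f assume f: "f \<in> {f \<in> \<Omega> \<rightarrow>\<^sub>E \<Omega>. \<phi> f \<in> U}"
      then have \<phi>f: "\<phi> f \<in> U" by simp
      obtain F where F: "finite F" "F \<subseteq> \<Omega>"
          "\<forall>g\<in>\<Omega> \<rightarrow>\<^sub>E \<Omega>. (\<forall>x\<in>F. g x = \<phi> f x) \<longrightarrow> g \<in> U"
        using openin_pointwise_topologyD[OF U \<phi>f] by (elim exE conjE) (rule that)
      have "\<phi> g \<in> U" if g: "g \<in> \<Omega> \<rightarrow>\<^sub>E \<Omega>" "\<forall>x\<in>y ` F. g x = f x" for g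
      proof (rule F(3)[rule_format, OF \<phi>[OF g(1)]])
        fix x assume "x \<in> F"
        then show "\<phi> g x = \<phi> f x"
          using y(2)[of x g f] f g F(2) by blast
      qed
      then show "\<exists>F. finite F \<and> F \<subseteq> \<Omega> \<and> (\<forall>g\<in>\<Omega> \<rightarrow>\<^sub>E \<Omega>. (\<forall>x\<in>F. g x = f x) \<longrightarrow>
          g \<in> {f \<in> \<Omega> \<rightarrow>\<^sub>E \<Omega>. \<phi> f \<in> U})"
        using F y(1) by (intro exI[of _ "y ` F"]) auto
    qed auto
    then show ?thesis
      using \<phi> by (auto simp: continuous_map_def)
  qed
  have "continuous_map (pointwise_topology \<Omega>) (pointwise_topology \<Omega>) (\<lambda>f. compose \<Omega> f s)"
    if s: "s \<in> \<Omega> \<rightarrow>\<^sub>E \<Omega>" for s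
  proof (rule cont)
    fix x assume "x \<in> \<Omega>"
    then show "\<exists>y\<in>\<Omega>. \<forall>f\<in>\<Omega> \<rightarrow>\<^sub>E \<Omega>. \<forall>g\<in>\<Omega> \<rightarrow>\<^sub>E \<Omega>. f y = g y \<longrightarrow> compose \<Omega> f s x = compose \<Omega> g s x"
      using s by (intro bexI[of _ "s x"]) (auto simp: compose_def)
  qed (rule compose_in_PiE[OF _ s])
  moreover have "continuous_map (pointwise_topology \<Omega>) (pointwise_topology \<Omega>) (\<lambda>f. compose \<Omega> s f)"
    if s: "s \<in> \<Omega> \<rightarrow>\<^sub>E \<Omega>" for s
  proof (rule cont)
    fix x assume "x \<in> \<Omega>"
    then show "\<exists>y\<in>\<Omega>. \<forall>f\<in>\<Omega> \<rightarrow>\<^sub>E \<Omega>. \<forall>g\<in>\<Omega> \<rightarrow>\<^sub>E \<Omega>. f y = g y \<longrightarrow> compose \<Omega> s f x = compose \<Omega> s g x"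
      by (intro bexI[of _ x]) (auto simp: compose_def)
  qed (rule compose_in_PiE[OF s])
  ultimately show ?thesis
    unfolding semitopological_semigroup_def
    using m_assoc topspace_pointwise_topology[of \<Omega>]
    by (auto simp: full_transformation_monoid_def compose_in_PiE)
qed

section \<open>Competing topologies refine the pointwise topology\<close>

text \<open>Right multiplication by a constant map evaluates \<open>f\<close> at \<open>a\<close>,
  and a left multiplication then tests the value against \<open>b\<close>. The outcome is one of two
  constant maps, so closedness of a singleton makes the test \<open>T\<close>-closed.\<close>

lemma semitopological_finer_than_pointwise:
  assumes T1: "t1_space T"
    and semi: "semitopological_semigroup (full_transformation_monoid \<Omega>) T"
    and two: "p \<in> \<Omega>" "q \<in> \<Omega>" "p \<noteq> q"
    and U: "openin (pointwise_topology \<Omega>) U"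
  shows "openin T U"
proof -
  have top: "topspace T = \<Omega> \<rightarrow>\<^sub>E \<Omega>"
    and right: "\<And>s. s \<in> \<Omega> \<rightarrow>\<^sub>E \<Omega> \<Longrightarrow> continuous_map T T (\<lambda>f. compose \<Omega> f s)"
    and left: "\<And>s. s \<in> \<Omega> \<rightarrow>\<^sub>E \<Omega> \<Longrightarrow> continuous_map T T (\<lambda>f. compose \<Omega> s f)"
    using semi unfolding semitopological_semigroup_def full_transformation_monoid_def by auto
  define const where "const a = (\<lambda>x\<in>\<Omega>. a)" for a :: 'a
  have const: "const a \<in> \<Omega> \<rightarrow>\<^sub>E \<Omega>" if "a \<in> \<Omega>" for a
    using that by (auto simp: const_def)
  have point: "openin T {f \<in> \<Omega> \<rightarrow>\<^sub>E \<Omega>. f a = b}" if a: "a \<in> \<Omega>" and b: "b \<in> \<Omega>" for a b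
  proof -
    \<comment> \<open>With this \<open>s\<close>, the product with \<open>const a\<close> is
      \<open>const q\<close> exactly when \<open>f a \<noteq> b\<close>.\<close>
    define s where "s = (\<lambda>x\<in>\<Omega>. if x = b then p else q)"
    have s: "s \<in> \<Omega> \<rightarrow>\<^sub>E \<Omega>"
      using two by (auto simp: s_def)
    have "continuous_map T T (\<lambda>f. compose \<Omega> s (compose \<Omega> f (const a)))"
      using continuous_map_compose[OF right[OF const[OF a]] left[OF s]] by (simp add: o_def)
    moreover have "closedin T {const q}"
      using T1 const[OF two(2)] top by (simp add: closedin_t1_singleton)
    ultimately have "closedin T {f \<in> topspace T. compose \<Omega> s (compose \<Omega> f (const a)) \<in> {const q}}"
      by (rule closedin_continuous_map_preimage)
    moreover have "compose \<Omega> s (compose \<Omega> f (const a)) = const q \<longleftrightarrow> f a \<noteq> b"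
      if f: "f \<in> \<Omega> \<rightarrow>\<^sub>E \<Omega>" for f
    proof -
      have "compose \<Omega> s (compose \<Omega> f (const a)) = const (s (f a))"
        by (auto simp: compose_def const_def)
      moreover have "const (s (f a)) = const q \<longleftrightarrow> s (f a) = q"
        using a by (metis const_def restrict_apply')
      moreover have "s (f a) = q \<longleftrightarrow> f a \<noteq> b"
        using f a two by (auto simp: s_def)
      ultimately show ?thesis
        by simp
    qed
    ultimately have "closedin T {f \<in> \<Omega> \<rightarrow>\<^sub>E \<Omega>. f a \<noteq> b}"
      using top by (simp cong: conj_cong)
    then have "openin T (topspace T - {f \<in> \<Omega> \<rightarrow>\<^sub>E \<Omega>. f a \<noteq> b})"
      by blast
    moreover have "topspace T - {f \<in> \<Omega> \<rightarrow>\<^sub>E \<Omega>. f a \<noteq> b} = {f \<in> \<Omega> \<rightarrow>\<^sub>E \<Omega>. f a = b}"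
      using top by auto
    ultimately show ?thesis
      by simp
  qed
  show ?thesis
  proof (subst openin_subopen, rule ballI)
    fix f assume f: "f \<in> U"
    then have fE: "f \<in> \<Omega> \<rightarrow>\<^sub>E \<Omega>"
      using U unfolding openin_pointwise_topology by blast
    obtain F where F: "finite F" "F \<subseteq> \<Omega>"
        "\<forall>g\<in>\<Omega> \<rightarrow>\<^sub>E \<Omega>. (\<forall>x\<in>F. g x = f x) \<longrightarrow> g \<in> U"
      using openin_pointwise_topologyD[OF U f] by (elim exE conjE) (rule that)
    \<comment> \<open>The factor \<open>topspace T\<close> covers the case of empty
      \<open>F\<close>, where the intersection would be the whole type.\<close>
    let ?W = "topspace T \<inter> \<Inter>((\<lambda>x. {g \<in> \<Omega> \<rightarrow>\<^sub>E \<Omega>. g x = f x}) ` F)"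
    have "openin T ?W"
      using F fE by (intro openin_Int_Inter) (auto intro!: point)
    moreover have "f \<in> ?W" "?W \<subseteq> U"
      using fE top F(3) by auto
    ultimately show "\<exists>W. openin T W \<and> f \<in> W \<and> W \<subseteq> U"
      by blast
  qed
qed

section \<open>Surjections\<close>

text \<open>Left multiplication by a surjection is open, because values off a finite set can be
  lifted freely through \<open>t\<close>. Hence an interior point of the preimage of
  \<open>N\<close> maps to an interior point of \<open>N\<close>.\<close>

lemma meagre_in_preimage_surj:
  assumes t: "t \<in> \<Omega> \<rightarrow>\<^sub>E \<Omega>" "t ` \<Omega> = \<Omega>" and R: "meagre_in (pointwise_topology \<Omega>) R"
  shows "meagre_in (pointwise_topology \<Omega>) {h \<in> \<Omega> \<rightarrow>\<^sub>E \<Omega>. compose \<Omega> t h \<in> R}"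
proof -
  let ?P = "pointwise_topology \<Omega>"
  let ?pre = "\<lambda>N. {h \<in> topspace ?P. compose \<Omega> t h \<in> N}"
  obtain \<N> where \<N>: "countable \<N>" "\<And>N. N \<in> \<N> \<Longrightarrow> closedin ?P N"
      "\<And>N. N \<in> \<N> \<Longrightarrow> ?P interior_of N = {}" and cover: "R \<subseteq> \<Union>\<N>"
    using R unfolding meagre_in_def by blast
  have cont: "continuous_map ?P ?P (\<lambda>h. compose \<Omega> t h)"
    using pointwise_topology_semitopological[of \<Omega>] t(1)
    by (auto simp: semitopological_semigroup_def full_transformation_monoid_def)
  have "?P interior_of ?pre N = {}" if N: "N \<in> \<N>" for N
  proof (rule ccontr)
    assume "?P interior_of ?pre N \<noteq> {}"
    then obtain h where h: "h \<in> ?P interior_of ?pre N" by blast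
    then have hE: "h \<in> \<Omega> \<rightarrow>\<^sub>E \<Omega>"
      using interior_of_subset_topspace[of ?P] by auto
    obtain F where F: "finite F" "F \<subseteq> \<Omega>"
        "\<forall>g\<in>\<Omega> \<rightarrow>\<^sub>E \<Omega>. (\<forall>x\<in>F. g x = h x) \<longrightarrow> g \<in> ?P interior_of ?pre N"
      using openin_pointwise_topologyD[OF openin_interior_of h] by (elim exE conjE) (rule that)
    define W where "W = {k \<in> \<Omega> \<rightarrow>\<^sub>E \<Omega>. \<forall>x\<in>F. k x = t (h x)}"
    have "openin ?P W"
      unfolding openin_pointwise_topology W_def using F(1,2) by (auto intro!: exI[of _ F])
    moreover have "W \<subseteq> N"
    proof
      fix k assume k: "k \<in> W"
      \<comment> \<open>A lift of \<open>k\<close> through \<open>t\<close> that stays in the given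
        neighbourhood of \<open>h\<close>: on \<open>F\<close> it copies \<open>h\<close>, elsewhere
        it picks preimages.\<close>
      define g where "g = (\<lambda>x\<in>\<Omega>. if x \<in> F then h x else inv_into \<Omega> t (k x))"
      have kx: "k x \<in> t ` \<Omega>" if "x \<in> \<Omega>" for x
        using k that t(2) by (auto simp: W_def)
      have "g \<in> \<Omega> \<rightarrow>\<^sub>E \<Omega>"
        using hE inv_into_into[OF kx] by (auto simp: g_def)
      moreover have "\<forall>x\<in>F. g x = h x"
        using F(2) by (auto simp: g_def)
      ultimately have "g \<in> ?pre N"
        using F(3) interior_of_subset[of ?P "?pre N"] by blast
      moreover have "compose \<Omega> t g = k"
      proof
        fix x
        show "compose \<Omega> t g x = k x"
          using k kx[of x] f_inv_into_f[of "k x" t]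
          by (cases "x \<in> \<Omega>") (auto simp: compose_def g_def W_def PiE_iff extensional_def)
      qed
      ultimately show "k \<in> N"
        by simp
    qed
    ultimately have "W \<subseteq> ?P interior_of N"
      by (simp add: interior_of_maximal)
    moreover have "compose \<Omega> t h \<in> W"
      using compose_in_PiE[OF t(1) hE] F(2) by (auto simp: W_def compose_def)
    ultimately show False
      using \<N>(3)[OF N] by blast
  qed
  moreover have "closedin ?P (?pre N)" if "N \<in> \<N>" for N
    using closedin_continuous_map_preimage[OF cont \<N>(2)[OF that]] .
  ultimately have "meagre_in ?P (\<Union>N\<in>\<N>. ?pre N)"
    using \<N>(1) by (intro meagre_in_UN meagre_in_nowhere_dense) auto
  then show ?thesis
    using cover by (auto elim!: meagre_in_subset)
qed

text \<open>Omitting a fixed value \<open>b\<close> is a closed condition with empty interior: a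
  point outside any finite \<open>F\<close> can be redefined to have value \<open>b\<close>. There
  are countably many values to omit.\<close>

lemma meagre_in_nonsurj:
  assumes \<Omega>: "countable \<Omega>" "infinite \<Omega>"
  shows "meagre_in (pointwise_topology \<Omega>) {h \<in> \<Omega> \<rightarrow>\<^sub>E \<Omega>. h ` \<Omega> \<noteq> \<Omega>}"
proof -
  let ?P = "pointwise_topology \<Omega>"
  let ?N = "\<lambda>b. {h \<in> \<Omega> \<rightarrow>\<^sub>E \<Omega>. b \<notin> h ` \<Omega>}"
  have "meagre_in ?P (?N b)" if b: "b \<in> \<Omega>" for b
  proof (rule meagre_in_nowhere_dense)
    have "openin ?P {h \<in> \<Omega> \<rightarrow>\<^sub>E \<Omega>. b \<in> h ` \<Omega>}"
      unfolding openin_pointwise_topology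
    proof (intro conjI ballI)
      fix f assume "f \<in> {h \<in> \<Omega> \<rightarrow>\<^sub>E \<Omega>. b \<in> h ` \<Omega>}"
      then obtain x where "x \<in> \<Omega>" "b = f x"
        by blast
      then show "\<exists>F. finite F \<and> F \<subseteq> \<Omega> \<and> (\<forall>g\<in>\<Omega> \<rightarrow>\<^sub>E \<Omega>. (\<forall>x\<in>F. g x = f x) \<longrightarrow>
          g \<in> {h \<in> \<Omega> \<rightarrow>\<^sub>E \<Omega>. b \<in> h ` \<Omega>})"
        by (intro exI[of _ "{x}"]) (auto simp: image_iff intro!: bexI[of _ x])
    qed auto
    moreover have "topspace ?P - ?N b = {h \<in> \<Omega> \<rightarrow>\<^sub>E \<Omega>. b \<in> h ` \<Omega>}"
      by auto
    ultimately show "closedin ?P (?N b)"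
      by (auto simp: closedin_def)
    show "?P interior_of ?N b = {}"
    proof (rule ccontr)
      assume "?P interior_of ?N b \<noteq> {}"
      then obtain h where h: "h \<in> ?P interior_of ?N b" by blast
      then have hE: "h \<in> \<Omega> \<rightarrow>\<^sub>E \<Omega>"
        using interior_of_subset_topspace[of ?P] by auto
      obtain F where F: "finite F" "F \<subseteq> \<Omega>"
          "\<forall>g\<in>\<Omega> \<rightarrow>\<^sub>E \<Omega>. (\<forall>x\<in>F. g x = h x) \<longrightarrow> g \<in> ?P interior_of ?N b"
        using openin_pointwise_topologyD[OF openin_interior_of h] by (elim exE conjE) (rule that)
      obtain x where x: "x \<in> \<Omega>" "x \<notin> F"
        using \<Omega>(2) F(1) by (meson finite_subset subsetI)
      have "h(x := b) \<in> \<Omega> \<rightarrow>\<^sub>E \<Omega>"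
        using hE x b by (auto simp: PiE_iff extensional_def)
      moreover have "\<forall>z\<in>F. (h(x := b)) z = h z"
        using x(2) by auto
      ultimately have "h(x := b) \<in> ?N b"
        using F(3) interior_of_subset[of ?P "?N b"] by blast
      then show False
        using x(1) by (auto simp: image_iff)
    qed
  qed
  then have "meagre_in ?P (\<Union>b\<in>\<Omega>. ?N b)"
    using \<Omega>(1) by (intro meagre_in_UN) auto
  then show ?thesis
    by (rule meagre_in_subset) (auto simp: PiE_iff)
qed

section \<open>Factorization through surjections and the reverse comparison\<close>

text \<open>Number \<open>\<Omega>\<close> by the naturals. The even points carry a copy of
  \<open>s\<close>, reached through \<open>g\<close>, while the odd points enumerate
  \<open>\<Omega>\<close> and make \<open>\<tau> s\<close> surjective. The map \<open>y\<close>
  records that each coordinate of \<open>\<tau> s\<close> depends on one coordinate of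
  \<open>s\<close>, so \<open>\<tau>\<close> is pointwise continuous.\<close>

lemma surjective_factorization:
  assumes \<Omega>: "countable \<Omega>" "infinite \<Omega>"
  shows "\<exists>g\<in>\<Omega> \<rightarrow>\<^sub>E \<Omega>. \<exists>\<tau> y.
    (\<forall>s\<in>\<Omega> \<rightarrow>\<^sub>E \<Omega>. \<tau> s \<in> \<Omega> \<rightarrow>\<^sub>E \<Omega> \<and> \<tau> s ` \<Omega> = \<Omega> \<and> compose \<Omega> (\<tau> s) g = s) \<and>
    (\<forall>x\<in>\<Omega>. y x \<in> \<Omega> \<and> (\<forall>s s'. s (y x) = s' (y x) \<longrightarrow> \<tau> s x = \<tau> s' x))"
proof -
  define e where "e = from_nat_into \<Omega>"
  define i where "i = to_nat_on \<Omega>"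
  have ie: "i (e n) = n" and e: "e n \<in> \<Omega>" for n
    using \<Omega> by (auto simp: e_def i_def infinite_imp_nonempty from_nat_into)
  have ei: "e (i x) = x" if "x \<in> \<Omega>" for x
    using \<Omega> that by (auto simp: e_def i_def)
  define g where "g = (\<lambda>x\<in>\<Omega>. e (2 * i x))"
  define \<tau> where "\<tau> s = (\<lambda>x\<in>\<Omega>. if even (i x) then s (e (i x div 2)) else e (i x div 2))" for s
  have \<tau>: "\<tau> s \<in> \<Omega> \<rightarrow>\<^sub>E \<Omega> \<and> \<tau> s ` \<Omega> = \<Omega> \<and> compose \<Omega> (\<tau> s) g = s"
    if s: "s \<in> \<Omega> \<rightarrow>\<^sub>E \<Omega>" for s
  proof -
    have "\<tau> s \<in> \<Omega> \<rightarrow>\<^sub>E \<Omega>"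
      using e s PiE_mem[OF s] by (auto simp: \<tau>_def)
    moreover have "\<Omega> \<subseteq> \<tau> s ` \<Omega>"
    proof
      fix x assume "x \<in> \<Omega>"
      then have "\<tau> s (e (2 * i x + 1)) = x"
        using e ie ei by (simp add: \<tau>_def)
      then show "x \<in> \<tau> s ` \<Omega>"
        using e by (metis image_eqI)
    qed
    moreover have "compose \<Omega> (\<tau> s) g = s"
    proof
      fix x
      show "compose \<Omega> (\<tau> s) g x = s x"
        using s e ie ei by (cases "x \<in> \<Omega>") (auto simp: compose_def \<tau>_def g_def PiE_iff extensional_def)
    qed
    ultimately show ?thesis
      by auto
  qed
  have dep: "e (i x div 2) \<in> \<Omega> \<and>
      (\<forall>s s'. s (e (i x div 2)) = s' (e (i x div 2)) \<longrightarrow> \<tau> s x = \<tau> s' x)" for x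
    using e by (simp add: \<tau>_def)
  have "g \<in> \<Omega> \<rightarrow>\<^sub>E \<Omega>"
    using e by (auto simp: g_def)
  moreover have "\<forall>s\<in>\<Omega> \<rightarrow>\<^sub>E \<Omega>. \<tau> s \<in> \<Omega> \<rightarrow>\<^sub>E \<Omega> \<and> \<tau> s ` \<Omega> = \<Omega> \<and> compose \<Omega> (\<tau> s) g = s"
    by (rule ballI) (rule \<tau>)
  moreover have "\<forall>x\<in>\<Omega>. e (i x div 2) \<in> \<Omega> \<and>
      (\<forall>s s'. s (e (i x div 2)) = s' (e (i x div 2)) \<longrightarrow> \<tau> s x = \<tau> s' x)"
    by (rule ballI) (rule dep)
  ultimately show ?thesis
    by (intro bexI[of _ g] exI[of _ \<tau>] exI[of _ "\<lambda>x. e (i x div 2)"] conjI)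
qed

text \<open>Instead of a sequence, witnesses indexed by the finite subsets of
  \<open>\<Omega>\<close> approach \<open>s\<close>. They are countably many, so a single generic
  \<open>h\<close> serves all of them.\<close>

lemma semitopological_coarser_than_pointwise:
  assumes \<Omega>: "countable \<Omega>" "infinite \<Omega>"
    and T: "Polish_topology T"
    and semi: "semitopological_semigroup (full_transformation_monoid \<Omega>) T"
    and finer: "\<And>U. openin (pointwise_topology \<Omega>) U \<Longrightarrow> openin T U"
    and U: "openin T U"
  shows "openin (pointwise_topology \<Omega>) U"
proof (rule ccontr)
  let ?P = "pointwise_topology \<Omega>"
  have ne: "\<Omega> \<noteq> {}"
    using \<Omega>(2) by auto
  have top: "topspace T = \<Omega> \<rightarrow>\<^sub>E \<Omega>"
    and right: "\<And>s. s \<in> \<Omega> \<rightarrow>\<^sub>E \<Omega> \<Longrightarrow> continuous_map T T (\<lambda>f. compose \<Omega> f s)"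
    using semi unfolding semitopological_semigroup_def full_transformation_monoid_def by auto
  have complete: "completely_metrizable_space ?P"
    using pointwise_topology_Polish[OF \<Omega>(1) ne] by (simp add: Polish_topology_def)
  have "Hausdorff_space ?P"
    by (simp add: complete completely_metrizable_imp_metrizable_space metrizable_imp_Hausdorff_space)
  then obtain R where R: "meagre_in ?P R"
    and agree: "\<And>U. openin T U \<Longrightarrow> \<exists>V. openin ?P V \<and> U - R = V - R"
    using Polish_refinement_agrees_off_meagre[OF T, of ?P] top finer by auto
  obtain g \<tau> y where g: "g \<in> \<Omega> \<rightarrow>\<^sub>E \<Omega>"
    and \<tau>: "\<forall>s\<in>\<Omega> \<rightarrow>\<^sub>E \<Omega>. \<tau> s \<in> \<Omega> \<rightarrow>\<^sub>E \<Omega> \<and> \<tau> s ` \<Omega> = \<Omega> \<and> compose \<Omega> (\<tau> s) g = s"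
    and y_dep: "\<forall>x\<in>\<Omega>. y x \<in> \<Omega> \<and> (\<forall>s s'. s (y x) = s' (y x) \<longrightarrow> \<tau> s x = \<tau> s' x)"
    using surjective_factorization[OF \<Omega>] by (elim bexE exE conjE) (rule that)
  note \<tau> = \<tau>[rule_format, THEN conjunct1] \<tau>[rule_format, THEN conjunct2, THEN conjunct1]
    \<tau>[rule_format, THEN conjunct2, THEN conjunct2]
  have y_in: "y x \<in> \<Omega>" if "x \<in> \<Omega>" for x
    using bspec[OF y_dep that] by (rule conjunct1)
  have \<tau>_cong: "\<tau> s x = \<tau> s' x" if "x \<in> \<Omega>" "s (y x) = s' (y x)" for x s s'
    using bspec[OF y_dep that(1)] that(2) by blast
  have U_sub: "U \<subseteq> \<Omega> \<rightarrow>\<^sub>E \<Omega>"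
    using openin_subset[OF U] top by simp
  assume "\<not> openin ?P U"
  then have "\<not> (\<forall>s\<in>U. \<exists>F. finite F \<and> F \<subseteq> \<Omega> \<and>
      (\<forall>f\<in>\<Omega> \<rightarrow>\<^sub>E \<Omega>. (\<forall>x\<in>F. f x = s x) \<longrightarrow> f \<in> U))"
    using U_sub by (simp only: openin_pointwise_topology simp_thms)
  then obtain s where s: "s \<in> U" and bad: "\<nexists>F. finite F \<and> F \<subseteq> \<Omega> \<and>
      (\<forall>f\<in>\<Omega> \<rightarrow>\<^sub>E \<Omega>. (\<forall>x\<in>F. f x = s x) \<longrightarrow> f \<in> U)"
    by (simp only: ball_simps) (elim bexE, rule that)
  \<comment> \<open>A failure of pointwise openness at \<open>s\<close> gives, for each finite
    \<open>F\<close>, a function outside \<open>U\<close> that agrees with \<open>s\<close> on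
    \<open>F\<close>.\<close>
  define \<sigma> where "\<sigma> F = (SOME f. f \<in> \<Omega> \<rightarrow>\<^sub>E \<Omega> \<and> (\<forall>x\<in>F. f x = s x) \<and> f \<notin> U)" for F
  have "\<sigma> F \<in> \<Omega> \<rightarrow>\<^sub>E \<Omega> \<and> (\<forall>x\<in>F. \<sigma> F x = s x) \<and> \<sigma> F \<notin> U" if F: "finite F" "F \<subseteq> \<Omega>" for F
  proof -
    have "\<exists>f. f \<in> \<Omega> \<rightarrow>\<^sub>E \<Omega> \<and> (\<forall>x\<in>F. f x = s x) \<and> f \<notin> U"
    proof (rule ccontr)
      assume "\<nexists>f. f \<in> \<Omega> \<rightarrow>\<^sub>E \<Omega> \<and> (\<forall>x\<in>F. f x = s x) \<and> f \<notin> U"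
      then have "\<forall>f\<in>\<Omega> \<rightarrow>\<^sub>E \<Omega>. (\<forall>x\<in>F. f x = s x) \<longrightarrow> f \<in> U"
        by metis
      with F have "\<exists>F. finite F \<and> F \<subseteq> \<Omega> \<and> (\<forall>f\<in>\<Omega> \<rightarrow>\<^sub>E \<Omega>. (\<forall>x\<in>F. f x = s x) \<longrightarrow> f \<in> U)"
        by (intro exI[of _ F] conjI)
      with bad show False
        by (rule notE)
    qed
    from someI_ex[OF this] show ?thesis
      unfolding \<sigma>_def .
  qed
  then have \<sigma>: "\<sigma> F \<in> \<Omega> \<rightarrow>\<^sub>E \<Omega>" "\<forall>x\<in>F. \<sigma> F x = s x" "\<sigma> F \<notin> U" if "finite F" "F \<subseteq> \<Omega>" for F
    using that by simp_all
  have sE: "s \<in> \<Omega> \<rightarrow>\<^sub>E \<Omega>"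
    using s U_sub by blast
  define Q where "Q = insert s (\<sigma> ` {F. finite F \<and> F \<subseteq> \<Omega>})"
  have "countable Q"
    unfolding Q_def using \<Omega>(1) by (intro countable_insert countable_image countable_Collect_finite_subset)
  have QE: "f \<in> \<Omega> \<rightarrow>\<^sub>E \<Omega>" if "f \<in> Q" for f
    using that sE \<sigma>(1) by (auto simp: Q_def)
  \<comment> \<open>The functions to avoid: those without a right inverse, and those carried into
    \<open>R\<close> by some \<open>\<tau> f\<close> with \<open>f\<close> in \<open>Q\<close>.
    Baire leaves an \<open>h\<close> outside.\<close>
  let ?bad = "{h \<in> \<Omega> \<rightarrow>\<^sub>E \<Omega>. h ` \<Omega> \<noteq> \<Omega>} \<union> (\<Union>f\<in>Q. {h \<in> \<Omega> \<rightarrow>\<^sub>E \<Omega>. compose \<Omega> (\<tau> f) h \<in> R})"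
  have "meagre_in ?P ?bad"
    by (intro meagre_in_Un meagre_in_UN meagre_in_preimage_surj meagre_in_nonsurj \<Omega> \<open>countable Q\<close> R
        \<tau>(1,2) QE)
  moreover have "\<not> meagre_in ?P (topspace ?P)"
    using Baire_not_meagre_in_topspace[OF complete] sE by auto
  ultimately have "\<not> topspace ?P \<subseteq> ?bad"
    using meagre_in_subset by blast
  then obtain h where h: "h \<in> \<Omega> \<rightarrow>\<^sub>E \<Omega>" "h ` \<Omega> = \<Omega>"
    and hR: "\<And>f. f \<in> Q \<Longrightarrow> compose \<Omega> (\<tau> f) h \<notin> R"
    by auto
  \<comment> \<open>Composing a right inverse of \<open>h\<close> with \<open>g\<close> gives
    \<open>h r = g\<close>, so right multiplication by \<open>r\<close> takes
    \<open>\<tau> f h\<close> back to \<open>f\<close>.\<close>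
  define r where "r = (\<lambda>x\<in>\<Omega>. inv_into \<Omega> h (g x))"
  have gx: "g x \<in> h ` \<Omega>" if "x \<in> \<Omega>" for x
    using g h(2) that by auto
  have r: "r \<in> \<Omega> \<rightarrow>\<^sub>E \<Omega>"
    using inv_into_into[OF gx] by (auto simp: r_def)
  have recover: "compose \<Omega> (compose \<Omega> (\<tau> f) h) r = f" if "f \<in> \<Omega> \<rightarrow>\<^sub>E \<Omega>" for f
  proof -
    have "compose \<Omega> (compose \<Omega> (\<tau> f) h) r = compose \<Omega> (\<tau> f) g"
      using inv_into_into[OF gx] f_inv_into_f[OF gx] by (auto simp: compose_def r_def fun_eq_iff)
    then show ?thesis
      using \<tau>(3)[OF that] by simp
  qed
  have "openin T {k \<in> \<Omega> \<rightarrow>\<^sub>E \<Omega>. compose \<Omega> k r \<in> U}"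
    using openin_continuous_map_preimage[OF right[OF r] U] unfolding top .
  from agree[OF this] obtain V where V: "openin ?P V"
    and UV: "{k \<in> \<Omega> \<rightarrow>\<^sub>E \<Omega>. compose \<Omega> k r \<in> U} - R = V - R"
    by (elim exE conjE) (rule that)
  \<comment> \<open>The points \<open>\<tau> f h\<close> avoid \<open>R\<close>, where alone
    \<open>V\<close> may differ from the preimage of \<open>U\<close> under multiplication by
    \<open>r\<close>.\<close>
  have in_V: "compose \<Omega> (\<tau> f) h \<in> V \<longleftrightarrow> f \<in> U" if "f \<in> Q" for f
  proof -
    let ?k = "compose \<Omega> (\<tau> f) h"
    have "?k \<in> \<Omega> \<rightarrow>\<^sub>E \<Omega>"
      by (intro compose_in_PiE \<tau>(1) QE that h(1))
    then have "?k \<in> {k \<in> \<Omega> \<rightarrow>\<^sub>E \<Omega>. compose \<Omega> k r \<in> U} - R \<longleftrightarrow> f \<in> U"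
      using hR[OF that] recover[OF QE[OF that]] by simp
    moreover have "?k \<in> V - R \<longleftrightarrow> ?k \<in> V"
      using hR[OF that] by simp
    ultimately show ?thesis
      unfolding UV by simp
  qed
  have sV: "compose \<Omega> (\<tau> s) h \<in> V"
    using in_V s by (auto simp: Q_def)
  then obtain F where F: "finite F" "F \<subseteq> \<Omega>"
      "\<forall>k\<in>\<Omega> \<rightarrow>\<^sub>E \<Omega>. (\<forall>x\<in>F. k x = compose \<Omega> (\<tau> s) h x) \<longrightarrow> k \<in> V"
    using openin_pointwise_topologyD[OF V sV] by (elim exE conjE) (rule that)
  \<comment> \<open>The coordinates of \<open>s\<close> that determine \<open>\<tau> s h\<close> on
    \<open>F\<close>. Agreement of \<open>\<sigma> G\<close> with \<open>s\<close> there puts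
    \<open>\<tau> (\<sigma> G) h\<close> into \<open>V\<close>, and so \<open>\<sigma> G\<close>
    into \<open>U\<close>, a contradiction.\<close>
  define G where "G = (\<lambda>x. y (h x)) ` F"
  have hF: "h x \<in> \<Omega>" if "x \<in> F" for x
    using that F(2) h(1) by auto
  have G: "finite G" "G \<subseteq> \<Omega>"
    using F(1) hF y_in by (auto simp: G_def)
  have "\<sigma> G \<in> Q"
    using G by (auto simp: Q_def)
  have "compose \<Omega> (\<tau> (\<sigma> G)) h x = compose \<Omega> (\<tau> s) h x" if "x \<in> F" for x
    using that \<tau>_cong[OF hF[OF that], of "\<sigma> G" s] \<sigma>(2)[OF G] F(2)
    by (auto simp: compose_def G_def)
  then have "compose \<Omega> (\<tau> (\<sigma> G)) h \<in> V"
    using F(3) compose_in_PiE[OF \<tau>(1)[OF \<sigma>(1)[OF G]] h(1)] by blast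
  then show False
    using in_V[OF \<open>\<sigma> G \<in> Q\<close>] \<sigma>(3)[OF G] by blast
qed

theorem theorem3p4:
  fixes \<Omega> :: "'a set"
  assumes "countable \<Omega>" and "infinite \<Omega>"
  shows "Polish_topology (pointwise_topology \<Omega>) \<and>
         semitopological_semigroup (full_transformation_monoid \<Omega>) (pointwise_topology \<Omega>) \<and>
         (\<forall>T. Polish_topology T \<and> semitopological_semigroup (full_transformation_monoid \<Omega>) T
              \<longrightarrow> T = pointwise_topology \<Omega>)"
proof (intro conjI allI impI)
  show "Polish_topology (pointwise_topology \<Omega>)"
    using assms by (intro pointwise_topology_Polish) auto
  show "semitopological_semigroup (full_transformation_monoid \<Omega>) (pointwise_topology \<Omega>)"
    by (rule pointwise_topology_semitopological)
next
  fix T assume T: "Polish_topology T \<and> semitopological_semigroup (full_transformation_monoid \<Omega>) T"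
  have t1: "t1_space T"
    using T by (simp add: Polish_topology_def completely_metrizable_imp_metrizable_space
        metrizable_imp_t1_space)
  obtain p where p: "p \<in> \<Omega>"
    using infinite_imp_nonempty[OF assms(2)] by blast
  obtain q where q: "q \<in> \<Omega>" "p \<noteq> q"
    using infinite_imp_nonempty[OF infinite_remove[OF assms(2), of p]] by blast
  have "openin T U" if "openin (pointwise_topology \<Omega>) U" for U
    using semitopological_finer_than_pointwise[OF t1 conjunct2[OF T] p q that] .
  then show "T = pointwise_topology \<Omega>"
    unfolding topology_eq
    using semitopological_coarser_than_pointwise[OF assms] T by blast
qed

end
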